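(* Let $\lambda,\mu\in(0,2]$ and $\kappa\in(0,+\infty)$ be such that $(\lambda,\mu,\kappa)\neq(2,2,1/2)$. Then there exist (nonempty) closed convex cones $A,B\subseteq \mathbb{R}^2$ and a starting point $x_0\in \mathbb{R}^2$ such that the operator $T = T_{\lambda,\mu}^{\kappa}$ generated by $(A,B)$ satisfies $\operatorname{Fix} T\neq \{0\}$ and, for any $n\in \mathbb{N}$, $T^n(x_0) \notin \operatorname{Fix} T$.
   Context: A set $S$ is a cone if $\alpha x\in S$ for all $x\in S$ and all $\alpha\in(0,+\infty)$. For a nonempty closed convex set $C\subseteq\mathbb{R}^2$, $P_C(x)$ is the unique nearest point of $C$ to $x$ in the Euclidean norm. For nonempty closed convex sets $A,B$ and parameters $\lambda,\mu\in(0,2]$, $\kappa\in(0,+\infty)$, put $P_A^{\lambda} = (1-\lambda)\mathrm{Id}+\lambda P_A$, $P_B^{\mu} = (1-\mu)\mathrm{Id}+\mu P_B$, and define the generalized projection operator $T_{\lambda,\mu}^{\kappa} = (1-\kappa)\mathrm{Id}+\kappa P_B^{\mu}\circ P_A^{\lambda}$. (The excluded choice $(2,2,1/2)$ gives the Douglas--Rachford operator.) $\operatorname{Fix} T=\{x: T(x)=x\}$, and $T^n$ is the $n$-fold composition. *)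

theory Defs
  imports "HOL-Analysis.Analysis"
begin

(* The library's cone allows the factor 0 (so it forces 0 into any nonempty cone);
   here only strictly positive factors are used. *)
definition pos_cone :: "'a::real_vector set \<Rightarrow> bool" where
  "pos_cone S \<longleftrightarrow> (\<forall>x\<in>S. \<forall>c>0. c *\<^sub>R x \<in> S)"

definition relaxed_proj :: "real \<Rightarrow> 'a::euclidean_space set \<Rightarrow> 'a \<Rightarrow> 'a" where
  "relaxed_proj l C x = (1 - l) *\<^sub>R x + l *\<^sub>R closest_point C x"

(* A is projected onto first, then B. *)
definition gen_proj ::
  "real \<Rightarrow> real \<Rightarrow> real \<Rightarrow> 'a::euclidean_space set \<Rightarrow> 'a set \<Rightarrow> 'a \<Rightarrow> 'a" where
  "gen_proj l m k A B x =
     (1 - k) *\<^sub>R x + k *\<^sub>R relaxed_proj m B (relaxed_proj l A x)"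

definition Fix :: "('a \<Rightarrow> 'a) \<Rightarrow> 'a set" where
  "Fix T = {x. T x = x}"

end

theory Submission imports Defs begin

text \<open>
  Let each of the two cones be the whole plane or a fixed line \<open>L\<close>. Then \<open>T\<close> is the identity
  on \<open>L\<close>, which provides nonzero fixed points, and on the orthogonal complement of \<open>L\<close> it
  multiplies by a number \<open>q\<close>. An orbit starting there never meets a fixed point if \<open>q\<close> is
  neither \<open>0\<close> nor \<open>1\<close>. The value of \<open>q\<close> is \<open>1 - k * m\<close> for plane and line, \<open>1 - k * l\<close> for
  line and plane, and \<open>1 - k * (1 - (1 - l) * (1 - m))\<close> for line and line.

  The first two are never \<open>1\<close>, and both vanish only if \<open>l = m = 1 / k\<close>. Then the third
  equals \<open>m - 1\<close>, which is \<open>1\<close> for \<open>m = 2\<close>, that is, for the excluded Douglas--Rachford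
  parameters \<open>(2, 2, 1/2)\<close>, and is \<open>0\<close> for \<open>m = 1\<close>, that is, for alternating projections
  \<open>(1, 1, 1)\<close>.

  In the case \<open>(1, 1, 1)\<close>, two lines meeting at an angle would do, were it not for the
  requirement of a nonzero fixed point. Replacing the second line by one of its two half
  planes repairs this: half of the first line then lies in both sets, while an orbit that
  is projected to the other half bounces between the two lines and shrinks by the factor
  \<open>cos\<^sup>2 (pi/4) = 1/2\<close> in each round.
\<close>

text \<open>
  This is the obtuse-angle criterion for metric projections, in the direction that allows a
  guessed projection to be verified.
\<close>

lemma closest_point_eqI:
  fixes C :: "'a::euclidean_space set"
  assumes "closed C" "convex C" "p \<in> C"
    and obtuse: "\<And>z. z \<in> C \<Longrightarrow> (x - p) \<bullet> (z - p) \<le> 0"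
  shows "closest_point C x = p"
proof -
  have "dist x p \<le> dist x z" if "z \<in> C" for z
  proof -
    have "(x - z) \<bullet> (x - z) = (x - p) \<bullet> (x - p) + (z - p) \<bullet> (z - p) - 2 * ((x - p) \<bullet> (z - p))"
      by (simp add: algebra_simps inner_commute)
    then have "(x - p) \<bullet> (x - p) \<le> (x - z) \<bullet> (x - z)"
      using obtuse[OF that] inner_ge_zero[of "z - p"] by linarith
    then show ?thesis
      by (simp add: dist_norm norm_le)
  qed
  then show ?thesis
    using closest_point_unique[of C p x] assms(1-3) by auto
qed

lemma relaxed_proj_self: "x \<in> C \<Longrightarrow> relaxed_proj t C x = x"
  by (simp add: relaxed_proj_def closest_point_self flip: scaleR_left_distrib)

lemma gen_proj_self: "x \<in> A \<Longrightarrow> x \<in> B \<Longrightarrow> gen_proj l m k A B x = x"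
  by (simp add: gen_proj_def relaxed_proj_self flip: scaleR_left_distrib)

lemma closest_point_hyperplane_normal:
  fixes e :: "'a::euclidean_space"
  shows "closest_point {x. e \<bullet> x = 0} (c *\<^sub>R e) = 0"
  by (rule closest_point_eqI) (auto simp: closed_hyperplane convex_hyperplane)

lemma relaxed_proj_hyperplane_normal:
  fixes e :: "'a::euclidean_space"
  shows "relaxed_proj t {x. e \<bullet> x = 0} (c *\<^sub>R e) = ((1 - t) * c) *\<^sub>R e"
  by (simp add: relaxed_proj_def closest_point_hyperplane_normal)

text \<open>
  Only the points \<open>q ^ n *\<^sub>R v\<close> are required to be scaled by \<open>q\<close>, rather than the whole line
  through \<open>v\<close>: for the half plane, scaling holds on a ray only.
\<close>

lemma geometric_orbit_not_fixed:
  fixes T :: "'a::real_vector \<Rightarrow> 'a"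
  assumes scale: "\<And>n::nat. T (q ^ n *\<^sub>R v) = q ^ Suc n *\<^sub>R v"
    and "q \<noteq> 0" "q \<noteq> 1" "v \<noteq> 0"
  shows "(T ^^ n) v \<notin> Fix T"
proof -
  have "(T ^^ n) v = q ^ n *\<^sub>R v"
    by (induction n) (use scale in auto)
  then show ?thesis
    using assms by (simp add: Fix_def)
qed

definition admissible_cone :: "'a::euclidean_space set \<Rightarrow> bool" where
  "admissible_cone C \<longleftrightarrow> C \<noteq> {} \<and> closed C \<and> convex C \<and> pos_cone C"

lemma admissible_cone_UNIV: "admissible_cone UNIV"
  by (simp add: admissible_cone_def pos_cone_def)

lemma admissible_cone_hyperplane: "admissible_cone {x. a \<bullet> x = 0}"
  by (auto simp: admissible_cone_def pos_cone_def closed_hyperplane convex_hyperplane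
      intro: exI[of _ 0])

lemma admissible_cone_halfspace: "admissible_cone {x. 0 \<le> a \<bullet> x}"
  using closed_halfspace_ge[of 0 a] convex_halfspace_ge[of 0 a]
  by (auto simp: admissible_cone_def pos_cone_def intro: exI[of _ 0])

lemma slow_cone_pairI:
  fixes A B :: "'a::euclidean_space set"
  assumes "admissible_cone A" "admissible_cone B"
    and "f \<in> A" "f \<in> B" "f \<noteq> 0"
    and "\<And>n::nat. gen_proj l m k A B (q ^ n *\<^sub>R v) = q ^ Suc n *\<^sub>R v"
    and "q \<noteq> 0" "q \<noteq> 1" "v \<noteq> 0"
  shows "\<exists>A B x0. admissible_cone A \<and> admissible_cone B \<and>
    Fix (gen_proj l m k A B) \<noteq> {0::'a} \<and>
    (\<forall>n. (gen_proj l m k A B ^^ n) x0 \<notin> Fix (gen_proj l m k A B))"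
proof (intro exI conjI allI)
  have "f \<in> Fix (gen_proj l m k A B)"
    using assms(3,4) by (simp add: Fix_def gen_proj_self)
  then show "Fix (gen_proj l m k A B) \<noteq> {0}"
    using \<open>f \<noteq> 0\<close> by blast
  show "(gen_proj l m k A B ^^ n) v \<notin> Fix (gen_proj l m k A B)" for n
    by (rule geometric_orbit_not_fixed) fact+
qed fact+

text \<open>
  With \<open>v = e - f\<close>, a positive multiple \<open>c *\<^sub>R v\<close> is first projected to \<open>- c *\<^sub>R f\<close>. As this
  point violates the constraint of the half space, it goes to the boundary, and there it
  lands on the line through \<open>v\<close> again.
\<close>

lemma gen_proj_hyperplane_halfspace:
  fixes e f :: "'a::euclidean_space"
  assumes "norm e = 1" "norm f = 1" "e \<bullet> f = 0" "0 < c"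
  shows "gen_proj 1 1 1 {x. e \<bullet> x = 0} {x. 0 \<le> (e + f) \<bullet> x} (c *\<^sub>R (e - f)) = (c / 2) *\<^sub>R (e - f)"
proof -
  have ip: "e \<bullet> e = 1" "f \<bullet> f = 1" "f \<bullet> e = 0"
    using assms by (simp_all add: dot_square_norm inner_commute)
  have line: "closest_point {x. e \<bullet> x = 0} (c *\<^sub>R (e - f)) = - c *\<^sub>R f"
  proof (rule closest_point_eqI)
    fix z assume "z \<in> {x. e \<bullet> x = 0}"
    then show "(c *\<^sub>R (e - f) - - c *\<^sub>R f) \<bullet> (z - - c *\<^sub>R f) \<le> 0"
      using assms(3) by (simp add: algebra_simps)
  qed (use assms in \<open>auto simp: closed_hyperplane convex_hyperplane\<close>)
  have half: "closest_point {x. 0 \<le> (e + f) \<bullet> x} (- c *\<^sub>R f) = (c / 2) *\<^sub>R (e - f)"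
  proof (rule closest_point_eqI)
    fix z assume z: "z \<in> {x. 0 \<le> (e + f) \<bullet> x}"
    \<comment> \<open>the residual is a negative multiple of the inner normal, hence the obtuse angle\<close>
    have "- c *\<^sub>R f - (c / 2) *\<^sub>R (e - f) = (- c / 2) *\<^sub>R (e + f)"
    proof -
      have "c *\<^sub>R f = (c / 2) *\<^sub>R f + (c / 2) *\<^sub>R f"
        by (simp flip: scaleR_left_distrib)
      then show ?thesis
        by (simp add: algebra_simps)
    qed
    moreover have "(e + f) \<bullet> (z - (c / 2) *\<^sub>R (e - f)) = (e + f) \<bullet> z"
      using assms(3) ip by (simp add: inner_diff_right inner_add_left)
    ultimately have "(- c *\<^sub>R f - (c / 2) *\<^sub>R (e - f)) \<bullet> (z - (c / 2) *\<^sub>R (e - f))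
        = (- c / 2) * ((e + f) \<bullet> z)"
      by (simp only: inner_scaleR_left)
    then show "(- c *\<^sub>R f - (c / 2) *\<^sub>R (e - f)) \<bullet> (z - (c / 2) *\<^sub>R (e - f)) \<le> 0"
      using z \<open>0 < c\<close> by (simp add: mult_nonneg_nonneg)
  qed (use assms(3) ip closed_halfspace_ge[of 0 "e + f"] convex_halfspace_ge[of 0 "e + f"]
       in \<open>auto simp: inner_diff_right inner_add_left\<close>)
  show ?thesis
    using line half by (simp add: gen_proj_def relaxed_proj_def)
qed

text \<open>
  The dimension enters only through the orthonormal pair \<open>e, f\<close>: the vector \<open>e\<close> is normal to
  the line (in general, hyperplane) and \<open>f\<close>, lying in it, is the nonzero fixed point.
\<close>

lemma slow_cone_pair_exists:
  fixes e f :: "'a::euclidean_space"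
  assumes "norm e = 1" "norm f = 1" "e \<bullet> f = 0"
    and "0 < l" "0 < m" "0 < k" "(l, m, k) \<noteq> (2, 2, 1/2)"
  shows "\<exists>A B x0. admissible_cone A \<and> admissible_cone B \<and>
    Fix (gen_proj l m k A B) \<noteq> {0::'a} \<and>
    (\<forall>n. (gen_proj l m k A B ^^ n) x0 \<notin> Fix (gen_proj l m k A B))"
proof -
  have nonzero: "e \<noteq> 0" "f \<noteq> 0"
    using assms(1,2) by auto
  let ?L = "{x. e \<bullet> x = 0}"
  consider "k * m \<noteq> 1" | "k * l \<noteq> 1" | "k * m = 1" "l = m" "m \<noteq> 1" | "l = 1" "m = 1" "k = 1"
  proof -
    have "l = m" if "k * m = 1" "k * l = 1"
      using that \<open>0 < k\<close> by (metis mult_left_cancel order_less_irrefl)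
    then show thesis
      using that by force
  qed
  then show ?thesis
  proof cases
    case 1
    have "gen_proj l m k UNIV ?L (c *\<^sub>R e) = ((1 - k * m) * c) *\<^sub>R e" for c
      by (simp add: gen_proj_def relaxed_proj_self relaxed_proj_hyperplane_normal
          flip: scaleR_left_distrib) (simp add: algebra_simps)
    then show ?thesis
      by (intro slow_cone_pairI[of UNIV ?L f l m k "1 - k * m" e])
        (use 1 assms nonzero admissible_cone_UNIV admissible_cone_hyperplane in auto)
  next
    case 2
    have "gen_proj l m k ?L UNIV (c *\<^sub>R e) = ((1 - k * l) * c) *\<^sub>R e" for c
      by (simp add: gen_proj_def relaxed_proj_self relaxed_proj_hyperplane_normal
          flip: scaleR_left_distrib) (simp add: algebra_simps)
    then show ?thesis
      by (intro slow_cone_pairI[of ?L UNIV f l m k "1 - k * l" e])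
        (use 2 assms nonzero admissible_cone_UNIV admissible_cone_hyperplane in auto)
  next
    case 3
    have "m \<noteq> 2"
      using 3 assms(7) by auto
    have q: "1 - k + k * ((1 - m) * (1 - m)) = m - 1"
    proof -
      have "1 - k + k * ((1 - m) * (1 - m)) = 1 - 2 * (k * m) + (k * m) * m"
        by (simp add: algebra_simps)
      then show ?thesis
        using 3 by simp
    qed
    have "gen_proj l m k ?L ?L (c *\<^sub>R e) = ((m - 1) * c) *\<^sub>R e" for c
    proof -
      have "gen_proj l m k ?L ?L (c *\<^sub>R e) = ((1 - k + k * ((1 - m) * (1 - m))) * c) *\<^sub>R e"
        using \<open>l = m\<close>
        by (simp add: gen_proj_def relaxed_proj_hyperplane_normal
            flip: scaleR_left_distrib) (simp add: algebra_simps)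
      then show ?thesis
        by (simp only: q)
    qed
    then show ?thesis
      by (intro slow_cone_pairI[of ?L ?L f l m k "m - 1" e])
        (use 3 \<open>m \<noteq> 2\<close> assms nonzero admissible_cone_hyperplane in auto)
  next
    case 4
    let ?H = "{x. 0 \<le> (e + f) \<bullet> x}"
    have "gen_proj l m k ?L ?H ((1 / 2) ^ n *\<^sub>R (e - f)) = (1 / 2) ^ Suc n *\<^sub>R (e - f)" for n :: nat
      using gen_proj_hyperplane_halfspace[OF assms(1-3), of "(1 / 2) ^ n"] 4 by simp
    moreover have "e \<noteq> f"
      using assms(3) nonzero by auto
    ultimately show ?thesis
      by (intro slow_cone_pairI[of ?L ?H f l m k "1 / 2" "e - f"])
        (use assms nonzero admissible_cone_hyperplane admissible_cone_halfspace[of "e + f"]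
         in \<open>auto simp: inner_add_left\<close>)
  qed
qed

theorem theorem2p6:
  fixes l m k :: real
  assumes "0 < l" "l \<le> 2" "0 < m" "m \<le> 2" "0 < k"
    and "(l, m, k) \<noteq> (2, 2, 1/2)"
  shows "\<exists>(A :: (real^2) set) (B :: (real^2) set) (x0 :: real^2).
    A \<noteq> {} \<and> closed A \<and> convex A \<and> pos_cone A \<and>
    B \<noteq> {} \<and> closed B \<and> convex B \<and> pos_cone B \<and>
    Fix (gen_proj l m k A B) \<noteq> {0} \<and>
    (\<forall>n::nat. (gen_proj l m k A B ^^ n) x0 \<notin> Fix (gen_proj l m k A B))"
proof -
  have "norm (axis 2 1 :: real^2) = 1" "norm (axis 1 1 :: real^2) = 1"
    "(axis 2 1 :: real^2) \<bullet> axis 1 1 = 0"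
    by (simp_all add: norm_axis_1 inner_axis_axis)
  from slow_cone_pair_exists[OF this assms(1,3,5,6)] show ?thesis
    unfolding admissible_cone_def by (simp only: conj_assoc)
qed

end
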